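(* Let $n\ge 1$, $A\in\mathbb R^{n\times n}$, $v,w\in\mathbb R^n$, and $A_2=A+vw^\top$. Assume that no product of two (complex) eigenvalues drawn from $\sigma(A)\cup\sigma(A_2)$ equals $1$ (self-pairs and repeats included), so that the three equations $$P=APA^\top+vv^\top,\qquad Q=A_2^\top QA_2+ww^\top,\qquad R=ARA_2+vw^\top$$ have unique solutions $P,Q,R\in\mathbb R^{n\times n}$. Assume in addition that $P$, $Q$ and $I+PQ$ are nonsingular. Then $$\sigma\bigl(P^{-1}RQ^{-1}R^\top\bigr)=\sigma\bigl((I+PQ)^{-1}\bigr).$$
   Context: $\sigma(M)$ denotes the multiset of complex eigenvalues of $M$, counted with algebraic multiplicity. If $\alpha_1,\dots,\alpha_n$ and $\beta_1,\dots,\beta_n$ enumerate $\sigma(A)$ and $\sigma(A_2)$, the spectral hypothesis says $\alpha_i\alpha_j\ne1$, $\beta_i\beta_j\ne1$, $\alpha_i\beta_j\ne1$ for all $i,j$; equivalently, $\delta_P=\det(I-A\otimes A)$, $\delta_Q=\det(I-A_2^\top\otimes A_2^\top)$ and $\delta_R=\det(I-A_2^\top\otimes A)$ are all nonzero. *)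

theory Defs
  imports
    "Jordan_Normal_Form.Char_Poly"
    "Jordan_Normal_Form.Gauss_Jordan_Elimination"
begin

text \<open>Algebraic multiplicity is multiplicity as a root of the characteristic polynomial over the
  complex numbers.\<close>

definition spec :: "real mat \<Rightarrow> complex multiset" where
  "spec M = proots (char_poly (map_mat complex_of_real M))"

definition outer_prod :: "real vec \<Rightarrow> real vec \<Rightarrow> real mat" where
  "outer_prod v w = mat (dim_vec v) (dim_vec w) (\<lambda>(i, j). v $ i * w $ j)"

text \<open>Only meaningful for invertible matrices; otherwise the value is unspecified.\<close>

definition inv_mat :: "real mat \<Rightarrow> real mat" where
  "inv_mat M = the (mat_inverse M)"

end

theory Submission
  imports Defs "Jordan_Normal_Form.Schur_Decomposition"
begin

text \<open>Write J for the inverse of P. Two auxiliary matrices reduce everything to uniqueness of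
  solutions of X = A X B + C. First, J satisfies a dual equation J = A^T J A + g g^T, where g comes
  from completing (A v) to a square matrix that is orthogonal for diag(P, 1). Since P is invertible,
  v is cyclic for A, so there is a symmetric K with K A = A^T K and K v = g; by uniqueness
  K P K = J, so U = P K is an involution. Second, w is cyclic for A2^T, so some N commuting
  with A2 satisfies w^T N = (g + s w)^T, where s is the remaining entry of the completed matrix. By
  uniqueness R N = U and N^T Q N = J + Q. Eliminating N gives
  J R Q^(-1) R^T = K (I + P Q)^(-1) K^(-1).\<close>

text \<open>Eigenvalues outside the unit disc are allowed, so the series for X = A X B + C may
  diverge and P may be indefinite; A and A2 may be singular or defective. Hence existence and
  uniqueness rest on annihilating products of shifts B - b, one resolvent of A per eigenvalue b, and
  the completing row has to be shown non-isotropic before it can be normalised. The given equations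
  do not link P, Q and R directly: P involves A alone, Q involves A2 alone, R involves both. The
  involution U is the bridge, since it also solves an equation with coefficients A and A2 and left
  factor v, so that changing the right factor w^T by means of N carries R to U. As U is its own
  inverse, R N = U also makes R invertible without assuming it. The argument runs over the complex
  numbers, where triangularisation is available; only the existence and uniqueness claims have to be
  brought back to real matrices.\<close>

lemma mat_assoc:
  "dim_col A = dim_row B \<Longrightarrow> dim_col B = dim_row C \<Longrightarrow> (A * B) * C = A * (B * (C :: 'a :: semiring_0 mat))"
  by (rule assoc_mult_mat) auto

lemma mat_distrib:
  fixes A B C :: "'a :: semiring_0 mat"
  shows "dim_col A = dim_row B \<Longrightarrow> dim_row B = dim_row C \<Longrightarrow> dim_col B = dim_col C \<Longrightarrow>
      A * (B + C) = A * B + A * C"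
    and "dim_row A = dim_row B \<Longrightarrow> dim_col A = dim_col B \<Longrightarrow> dim_col A = dim_row C \<Longrightarrow>
      (A + B) * C = A * C + B * C"
  by (rule mult_add_distrib_mat; auto) (rule add_mult_distrib_mat; auto)

lemma mat_diff_distrib:
  fixes A B C :: "'a :: ring mat"
  shows "dim_col A = dim_row B \<Longrightarrow> dim_row B = dim_row C \<Longrightarrow> dim_col B = dim_col C \<Longrightarrow>
      A * (B - C) = A * B - A * C"
    and "dim_row A = dim_row B \<Longrightarrow> dim_col A = dim_col B \<Longrightarrow> dim_col A = dim_row C \<Longrightarrow>
      (A - B) * C = A * C - B * C"
  by (rule mult_minus_distrib_mat; auto) (rule minus_mult_distrib_mat; auto)

lemma mat_smult:
  fixes A B :: "'a :: comm_semiring_0 mat"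
  shows "dim_col A = dim_row B \<Longrightarrow> A * (k \<cdot>\<^sub>m B) = k \<cdot>\<^sub>m (A * B)"
    and "dim_col A = dim_row B \<Longrightarrow> (k \<cdot>\<^sub>m A) * B = k \<cdot>\<^sub>m (A * B)"
  by (rule mult_smult_distrib; auto) (rule mult_smult_assoc_mat; auto)

lemma mat_transpose:
  fixes A B :: "'a :: comm_semiring_0 mat"
  shows "dim_col A = dim_row B \<Longrightarrow> transpose_mat (A * B) = transpose_mat B * transpose_mat A"
    and "dim_row A = dim_row C \<Longrightarrow> dim_col A = dim_col C \<Longrightarrow>
      transpose_mat (A + C) = transpose_mat A + transpose_mat C"
    and "transpose_mat (k \<cdot>\<^sub>m A) = k \<cdot>\<^sub>m transpose_mat A"
  by (rule transpose_mult; auto) (rule eq_matI; auto)+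

text \<open>The premises are equations between dimensions, which simp can discharge; membership in
  \<open>carrier_mat\<close> would leave sizes to be guessed.\<close>

lemmas mat_ring = mat_assoc mat_distrib mat_diff_distrib mat_smult mat_transpose

text \<open>The eigenvalues of X |-> A X B over the complex numbers are the products a * b, so this
  says that X |-> X - A X B is bijective.\<close>

definition nonresonant :: "'a :: comm_ring_1 mat \<Rightarrow> 'a mat \<Rightarrow> bool" where
  "nonresonant A B \<longleftrightarrow>
    (\<forall>a b. poly (char_poly A) a = 0 \<longrightarrow> poly (char_poly B) b = 0 \<longrightarrow> a * b \<noteq> 1)"

text \<open>Over a field this is the algebra of polynomials in A. The description by commutation
  avoids evaluating polynomials at matrices and makes closure under inverses immediate.\<close>

definition bicommutant :: "nat \<Rightarrow> 'a :: semiring_0 mat \<Rightarrow> 'a mat set" where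
  "bicommutant n A = {M \<in> carrier_mat n n. \<forall>N \<in> carrier_mat n n. N * A = A * N \<longrightarrow> N * M = M * N}"

subsection \<open>The equation X = A X B + C\<close>

text \<open>A nonzero kernel vector x of 1 - b A satisfies x = b A x. Hence b is nonzero and x is an
  eigenvector of A for 1/b, but (1/b) * b = 1 is excluded.\<close>

lemma resolvent_inverse:
  fixes A :: "'a :: field mat"
  assumes A: "A \<in> carrier_mat n n"
    and b: "\<And>a. poly (char_poly A) a = 0 \<Longrightarrow> a * b \<noteq> 1"
  obtains J where "J \<in> carrier_mat n n" "J * (1\<^sub>m n - b \<cdot>\<^sub>m A) = 1\<^sub>m n"
    "(1\<^sub>m n - b \<cdot>\<^sub>m A) * J = 1\<^sub>m n"
proof -
  let ?S = "1\<^sub>m n - b \<cdot>\<^sub>m A"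
  have S: "?S \<in> carrier_mat n n" using A by auto
  have "det ?S \<noteq> 0"
  proof
    assume "det ?S = 0"
    then obtain x where x: "x \<in> carrier_vec n" "x \<noteq> 0\<^sub>v n" and Sx: "?S *\<^sub>v x = 0\<^sub>v n"
      using det_0_iff_vec_prod_zero_field[OF S] by auto
    have e: "x = b \<cdot>\<^sub>v (A *\<^sub>v x)"
    proof (rule eq_vecI)
      fix i assume "i < dim_vec (b \<cdot>\<^sub>v (A *\<^sub>v x))"
      hence i: "i < n" using A by auto
      have "(?S *\<^sub>v x) $ i = x $ i - b * (A *\<^sub>v x) $ i"
      proof -
        have "?S *\<^sub>v x = 1\<^sub>m n *\<^sub>v x - (b \<cdot>\<^sub>m A) *\<^sub>v x"
          by (rule minus_mult_distrib_mat_vec, insert A x, auto)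
        also have "\<dots> $ i = x $ i - b * (A *\<^sub>v x) $ i"
          using A x i by (simp add: scalar_prod_def sum_distrib_left mult.assoc)
        finally show ?thesis .
      qed
      thus "x $ i = (b \<cdot>\<^sub>v (A *\<^sub>v x)) $ i" using Sx i A by auto
    qed (insert x A, auto)
    have b0: "b \<noteq> 0"
    proof
      assume "b = 0"
      hence "x = 0\<^sub>v n" by (subst e) (insert A, auto)
      thus False using x by auto
    qed
    have "A *\<^sub>v x = (1/b) \<cdot>\<^sub>v x"
    proof (rule eq_vecI)
      fix i assume "i < dim_vec ((1/b) \<cdot>\<^sub>v x)"
      hence i: "i < n" using x by auto
      have "x $ i = b * (A *\<^sub>v x) $ i" using arg_cong[OF e, of "\<lambda>y. y $ i"] i A by simp
      thus "(A *\<^sub>v x) $ i = ((1/b) \<cdot>\<^sub>v x) $ i" using i x b0 by auto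
    qed (insert x A, auto)
    hence "eigenvalue A (1/b)" unfolding eigenvalue_def eigenvector_def using x A by auto
    hence "poly (char_poly A) (1/b) = 0" using eigenvalue_root_char_poly[OF A] by auto
    from b[OF this] b0 show False by auto
  qed
  from det_non_zero_imp_unit[OF S this, of "()"]
  obtain J where "J \<in> carrier_mat n n" "J * ?S = 1\<^sub>m n" "?S * J = 1\<^sub>m n"
    unfolding Units_def ring_mat_def by auto
  thus thesis by (rule that)
qed

text \<open>Each factor clears one more column. In entry (i, j) with j <= k, the summands with m < k
  vanish by induction, those with m > j by triangularity, and m = j = k by the subtracted diagonal
  entry. The arbitrary start C fits inductions that absorb one factor at a time.\<close>

lemma upper_triangular_diagonal_product:
  fixes T :: "'a :: comm_ring_1 mat"
  assumes T: "T \<in> carrier_mat n n" and ut: "upper_triangular T" and C: "C \<in> carrier_mat n n"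
  shows "k \<le> n \<Longrightarrow> foldl (\<lambda>C b. C * (T - b \<cdot>\<^sub>m 1\<^sub>m n)) C (take k (diag_mat T)) \<in> carrier_mat n n \<and>
    (\<forall>i<n. \<forall>j<k. foldl (\<lambda>C b. C * (T - b \<cdot>\<^sub>m 1\<^sub>m n)) C (take k (diag_mat T)) $$ (i, j) = 0)"
proof (induction k)
  case 0
  then show ?case using C by auto
next
  case (Suc k)
  let ?F = "\<lambda>k. foldl (\<lambda>C b. C * (T - b \<cdot>\<^sub>m 1\<^sub>m n)) C (take k (diag_mat T))"
  have k: "k < n" using Suc by auto
  have IH: "?F k \<in> carrier_mat n n" "\<And>i j. i < n \<Longrightarrow> j < k \<Longrightarrow> ?F k $$ (i,j) = 0"
    using Suc by auto
  have step: "?F (Suc k) = ?F k * (T - T $$ (k,k) \<cdot>\<^sub>m 1\<^sub>m n)"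
    using k T by (simp add: take_Suc_conv_app_nth diag_mat_def)
  have "?F (Suc k) $$ (i,j) = 0" if i: "i < n" and j: "j < Suc k" for i j
  proof -
    have "?F (Suc k) $$ (i,j) = (\<Sum>m\<in>{0..<n}. ?F k $$ (i,m) * (T - T $$ (k,k) \<cdot>\<^sub>m 1\<^sub>m n) $$ (m,j))"
      unfolding step using IH(1) T i j k by (subst index_mult_mat) (auto simp: scalar_prod_def)
    also have "\<dots> = 0"
    proof (rule sum.neutral, intro ballI)
      fix m assume m: "m \<in> {0..<n}"
      consider "m < k" | "m = k" "j = k" | "j < m" using j by linarith
      then show "?F k $$ (i,m) * (T - T $$ (k,k) \<cdot>\<^sub>m 1\<^sub>m n) $$ (m,j) = 0"
        by cases (insert IH(2)[of i m] i m j k T upper_triangularD[OF ut, of j m], auto)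
    qed
    finally show ?thesis .
  qed
  moreover have "?F (Suc k) \<in> carrier_mat n n" unfolding step using IH T by auto
  ultimately show ?case by blast
qed

text \<open>Cayley-Hamilton in factored form: B is triangularised by a Schur decomposition, and the
  list is the diagonal of the triangular matrix. The factors stay separate because the Sylvester
  arguments remove one eigenvalue per step.\<close>

lemma eigenvalue_product_annihilates:
  fixes B :: "complex mat"
  assumes B: "B \<in> carrier_mat n n"
  obtains bs where "\<forall>b \<in> set bs. poly (char_poly B) b = 0"
    and "\<And>C. C \<in> carrier_mat n n \<Longrightarrow> foldl (\<lambda>C b. C * (B - b \<cdot>\<^sub>m 1\<^sub>m n)) C bs = 0\<^sub>m n n"
proof -
  obtain es where "char_poly B = (\<Prod>a\<leftarrow>es. [:- a, 1:])" using char_poly_factorized[OF B] by auto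
  from schur_decomposition_exists[OF B this] obtain T where
    T: "T \<in> carrier_mat n n" "upper_triangular T" and sim: "similar_mat B T" by auto
  from sim obtain S S' where wit: "similar_mat_wit B T S S'" unfolding similar_mat_def by auto
  note w = similar_mat_witD2[OF B wit]
  let ?bs = "diag_mat T"
  have cp: "char_poly B = (\<Prod>a\<leftarrow>?bs. [:- a, 1:])"
    using char_poly_similar[OF sim] char_poly_upper_triangular[OF T] by simp
  have 1: "\<forall>b \<in> set ?bs. poly (char_poly B) b = 0"
    unfolding cp by (auto simp: poly_prod_list prod_list_zero_iff)
  \<comment> \<open>B S = S T lets S pass through every factor and turns shifts of B into shifts of
    T.\<close>
  have shift: "foldl (\<lambda>C b. C * (B - b \<cdot>\<^sub>m 1\<^sub>m n)) C bs \<in> carrier_mat n n \<and>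
      foldl (\<lambda>C b. C * (B - b \<cdot>\<^sub>m 1\<^sub>m n)) C bs * S = foldl (\<lambda>C b. C * (T - b \<cdot>\<^sub>m 1\<^sub>m n)) (C * S) bs"
    if "C \<in> carrier_mat n n" for C bs
    using that
  proof (induction bs arbitrary: C)
    case (Cons b bs)
    have BS: "B * S = S * T" unfolding w(3) using w(2,4-7) by (simp add: mat_ring)
    have "C * (B - b \<cdot>\<^sub>m 1\<^sub>m n) * S = C * S * (T - b \<cdot>\<^sub>m 1\<^sub>m n)"
      using Cons.prems w(4-7) BS by (simp add: mat_ring)
    moreover have "C * (B - b \<cdot>\<^sub>m 1\<^sub>m n) \<in> carrier_mat n n" using Cons.prems B by auto
    ultimately show ?case using Cons.IH[of "C * (B - b \<cdot>\<^sub>m 1\<^sub>m n)"] by simp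
  qed auto
  have "foldl (\<lambda>C b. C * (B - b \<cdot>\<^sub>m 1\<^sub>m n)) C ?bs = 0\<^sub>m n n" (is "?L = _") if C: "C \<in> carrier_mat n n" for C
  proof -
    have L: "?L \<in> carrier_mat n n" and LS: "?L * S = foldl (\<lambda>C b. C * (T - b \<cdot>\<^sub>m 1\<^sub>m n)) (C * S) ?bs"
      using shift[OF C] by auto
    have len: "length ?bs = n" using T by (auto simp: diag_mat_def)
    have "C * S \<in> carrier_mat n n" using C w by auto
    from upper_triangular_diagonal_product[OF T this, of n] len
    have "?L * S = 0\<^sub>m n n" unfolding LS by (intro eq_matI) auto
    hence "?L * S * S' = 0\<^sub>m n n" using w by simp
    moreover have "?L * S * S' = ?L" using L w by (simp add: mat_ring)
    ultimately show ?thesis by simp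
  qed
  from that[OF 1 this] show thesis .
qed

lemma mat_eq_iff_index:
  "dim_row A = dim_row B \<Longrightarrow> dim_col A = dim_col B \<Longrightarrow>
    A = B \<longleftrightarrow> (\<forall>i < dim_row B. \<forall>j < dim_col B. A $$ (i, j) = B $$ (i, j))"
  by (auto intro: eq_matI)

text \<open>Let Z = A Z B be the difference of two solutions. Then Z (B - b) solves the same
  homogeneous equation and has one annihilating factor fewer, so it is 0 by induction. Thus Z B = b
  Z and (1 - b A) Z = 0, and the resolvent gives Z = 0.\<close>

lemma sylvester_unique:
  fixes A B :: "complex mat"
  assumes A: "A \<in> carrier_mat n n" and B: "B \<in> carrier_mat n n" and nr: "nonresonant A B"
    and X: "X \<in> carrier_mat n n" "X = A * X * B + C"
    and Y: "Y \<in> carrier_mat n n" "Y = A * Y * B + C"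
    and C: "C \<in> carrier_mat n n"
  shows "X = Y"
proof -
  obtain bs where bs: "\<forall>b \<in> set bs. poly (char_poly B) b = 0"
    and ann: "\<And>C. C \<in> carrier_mat n n \<Longrightarrow> foldl (\<lambda>C b. C * (B - b \<cdot>\<^sub>m 1\<^sub>m n)) C bs = 0\<^sub>m n n"
    using eigenvalue_product_annihilates[OF B] by blast
  have hom: "Z = 0\<^sub>m n n"
    if "Z \<in> carrier_mat n n" "Z = A * Z * B" "foldl (\<lambda>C b. C * (B - b \<cdot>\<^sub>m 1\<^sub>m n)) Z bs = 0\<^sub>m n n" for Z
    using that bs
  proof (induction bs arbitrary: Z)
    case (Cons b bs)
    note Z = Cons.prems(1,2)
    let ?Z = "Z * (B - b \<cdot>\<^sub>m 1\<^sub>m n)"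
    have Z': "?Z \<in> carrier_mat n n" using Z B by auto
    have "?Z = A * Z * B * (B - b \<cdot>\<^sub>m 1\<^sub>m n)" using Z(2) by simp
    also have "\<dots> = A * ?Z * B" using Z(1) A B by (simp add: mat_ring)
    finally have "?Z = A * ?Z * B" .
    with Cons.IH[OF Z'] Cons.prems have Z0: "?Z = 0\<^sub>m n n" by auto
    from Cons.prems have "poly (char_poly B) b = 0" by auto
    then obtain J where J: "J \<in> carrier_mat n n" "J * (1\<^sub>m n - b \<cdot>\<^sub>m A) = 1\<^sub>m n"
      using resolvent_inverse[OF A, of b] nr unfolding nonresonant_def by blast
    have RC: "1\<^sub>m n - b \<cdot>\<^sub>m A \<in> carrier_mat n n" using A by auto
    have "(1\<^sub>m n - b \<cdot>\<^sub>m A) * Z = Z - b \<cdot>\<^sub>m (A * Z)" using A Z(1) by (simp add: mat_ring)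
    also have "\<dots> = A * Z * B - b \<cdot>\<^sub>m (A * Z)" using Z(2) by simp
    also have "\<dots> = A * ?Z" using Z(1) A B by (simp add: mat_ring)
    finally have "(1\<^sub>m n - b \<cdot>\<^sub>m A) * Z = 0\<^sub>m n n" using Z0 A by simp
    hence "J * ((1\<^sub>m n - b \<cdot>\<^sub>m A) * Z) = 0\<^sub>m n n" using J by simp
    moreover have "J * ((1\<^sub>m n - b \<cdot>\<^sub>m A) * Z) = Z"
      using assoc_mult_mat[OF J(1) RC Z(1)] J Z(1) by simp
    ultimately show ?case by simp
  qed auto
  have XY: "X - Y \<in> carrier_mat n n" using X(1) Y(1) by auto
  have "X - Y = (A * X * B + C) - (A * Y * B + C)" using X(2) Y(2) by simp
  also have "\<dots> = A * X * B - A * Y * B" using X(1) Y(1) A B C by (intro eq_matI) auto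
  also have "\<dots> = A * (X - Y) * B" using X(1) Y(1) A B by (simp add: mat_ring)
  finally have "X - Y = 0\<^sub>m n n" using hom[OF XY] ann[OF XY] by auto
  thus ?thesis using X(1) Y(1) by (auto simp: mat_eq_iff_index)
qed

section \<open>Closure properties of the bicommutant\<close>

lemma bicommutant_carrier: "M \<in> bicommutant n A \<Longrightarrow> M \<in> carrier_mat n n"
  by (simp add: bicommutant_def)

lemma bicommutant_commutes:
  assumes A: "A \<in> carrier_mat n n" and M: "M \<in> bicommutant n A" and N: "N \<in> bicommutant n A"
  shows "M * N = N * M" "M * A = A * M"
proof -
  show 1: "M * A = A * M" using M A unfolding bicommutant_def by auto
  show "M * N = N * M" using M N 1 unfolding bicommutant_def by auto
qed

lemma bicommutantI:
  assumes "M \<in> carrier_mat n n"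
    "\<And>N. N \<in> carrier_mat n n \<Longrightarrow> N * A = A * N \<Longrightarrow> N * M = M * N"
  shows "M \<in> bicommutant n A"
  using assms by (simp add: bicommutant_def)

lemma bicommutant_self: "A \<in> carrier_mat n n \<Longrightarrow> A \<in> bicommutant n A"
  by (rule bicommutantI) auto

lemma bicommutant_smult:
  "M \<in> bicommutant n A \<Longrightarrow> k \<cdot>\<^sub>m (M :: 'a :: comm_semiring_0 mat) \<in> bicommutant n A"
  by (rule bicommutantI) (auto simp: bicommutant_def mat_ring)

lemma bicommutant_one: "1\<^sub>m n \<in> bicommutant n (A :: 'a :: semiring_1 mat)"
  by (rule bicommutantI) auto

lemma bicommutant_add:
  "M \<in> bicommutant n A \<Longrightarrow> M' \<in> bicommutant n A \<Longrightarrow> M + M' \<in> bicommutant n A"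
  by (rule bicommutantI) (auto simp: bicommutant_def mat_ring)

lemma bicommutant_mult:
  assumes "M \<in> bicommutant n A" "M' \<in> bicommutant n A"
  shows "M * M' \<in> bicommutant n A"
proof (rule bicommutantI)
  fix N assume N: "N \<in> carrier_mat n n" "N * A = A * N"
  have c: "M \<in> carrier_mat n n" "M' \<in> carrier_mat n n" "N * M = M * N" "N * M' = M' * N"
    using assms N by (auto simp: bicommutant_def)
  have "N * (M * M') = M * N * M'" using c N by (simp add: mat_assoc flip: c(3))
  also have "\<dots> = M * M' * N" using c N by (simp add: mat_assoc)
  finally show "N * (M * M') = M * M' * N" .
qed (insert assms, auto simp: bicommutant_def)

text \<open>Whatever commutes with M commutes with its inverse. This places the resolvents of A in
  the bicommutant.\<close>

lemma bicommutant_inverse: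
  assumes M: "M \<in> bicommutant n (A :: 'a :: semiring_1 mat)" and J: "J \<in> carrier_mat n n"
    and JM: "J * M = 1\<^sub>m n" "M * J = 1\<^sub>m n"
  shows "J \<in> bicommutant n A"
proof (rule bicommutantI[OF J])
  fix N assume N: "N \<in> carrier_mat n n" "N * A = A * N"
  have c: "M \<in> carrier_mat n n" "N * M = M * N" using M N by (auto simp: bicommutant_def)
  have "N * J = J * M * (N * J)" using JM N J by simp
  also have "\<dots> = J * (N * M) * J" using c N J by (simp add: mat_assoc)
  also have "\<dots> = J * N * (M * J)" using c(1) N J by (simp add: mat_assoc)
  finally show "N * J = J * N" using JM N J by simp
qed

text \<open>The range of X lies in the Krylov space of A and the column V, with the bicommutant in
  place of the polynomials in A.\<close>

definition cyclic_range :: "nat \<Rightarrow> 'a :: semiring_0 mat \<Rightarrow> 'a mat \<Rightarrow> 'a mat \<Rightarrow> bool" where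
  "cyclic_range n A V X \<longleftrightarrow> (\<forall>y \<in> carrier_mat n 1. \<exists>M \<in> bicommutant n A. X * y = M * V)"

text \<open>The induction builds the solution from C by resolvents of A, multiplication by A and
  right multiplication by shifts of B. None of these leaves the Krylov space of V, so the range
  condition passes from C to X.\<close>

lemma sylvester_exists:
  fixes A B :: "complex mat"
  assumes A: "A \<in> carrier_mat n n" and B: "B \<in> carrier_mat n n" and nr: "nonresonant A B"
    and C: "C \<in> carrier_mat n n" and V: "V \<in> carrier_mat n 1"
  obtains X where "X \<in> carrier_mat n n" "X = A * X * B + C"
    "cyclic_range n A V C \<Longrightarrow> cyclic_range n A V X"
proof -
  obtain bs where bs: "\<forall>b \<in> set bs. poly (char_poly B) b = 0"
    and ann: "\<And>C. C \<in> carrier_mat n n \<Longrightarrow> foldl (\<lambda>C b. C * (B - b \<cdot>\<^sub>m 1\<^sub>m n)) C bs = 0\<^sub>m n n"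
    using eigenvalue_product_annihilates[OF B] by blast
  have "\<exists>X \<in> carrier_mat n n. X = A * X * B + C \<and> (cyclic_range n A V C \<longrightarrow> cyclic_range n A V X)"
    using C ann[OF C] bs
  proof (induction bs arbitrary: C)
    case Nil
    hence "C = 0\<^sub>m n n" by simp
    moreover have "0\<^sub>m n n = A * 0\<^sub>m n n * B + 0\<^sub>m n n" using A B by simp
    ultimately show ?case by (metis zero_carrier_mat)
  next
    case (Cons b bs)
    note C = Cons.prems(1)
    let ?D = "B - b \<cdot>\<^sub>m 1\<^sub>m n"
    have D: "?D \<in> carrier_mat n n" using B by auto
    have CD: "C * ?D \<in> carrier_mat n n" using C D by auto
    from Cons.IH[OF CD] Cons.prems obtain X where X: "X \<in> carrier_mat n n"
      and eq: "X = A * X * B + C * ?D"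
      and cyc: "cyclic_range n A V (C * ?D) \<longrightarrow> cyclic_range n A V X" by auto
    from Cons.prems have "poly (char_poly B) b = 0" by auto
    then obtain J where J: "J \<in> carrier_mat n n" "J * (1\<^sub>m n - b \<cdot>\<^sub>m A) = 1\<^sub>m n"
      "(1\<^sub>m n - b \<cdot>\<^sub>m A) * J = 1\<^sub>m n"
      using resolvent_inverse[OF A, of b] nr unfolding nonresonant_def by blast
    let ?R = "1\<^sub>m n - b \<cdot>\<^sub>m A"
    have "?R = 1\<^sub>m n + (- b) \<cdot>\<^sub>m A" using A by (auto simp: mat_eq_iff_index)
    hence "?R \<in> bicommutant n A"
      using A by (simp add: bicommutant_add bicommutant_one bicommutant_smult bicommutant_self)
    from bicommutant_inverse[OF this J] have Jb: "J \<in> bicommutant n A" .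
    have JA: "J * A = A * J" using bicommutant_commutes[OF A Jb Jb] by simp
    \<comment> \<open>If Y = A Y B + C, then X = Y (B - b) solves the equation with right-hand side
      C (B - b), and replacing Y B by b Y + X gives (1 - b A) Y = C + A X. Solving for Y yields the
      witness.\<close>
    let ?Y = "J * (C + A * X)"
    have Y: "?Y \<in> carrier_mat n n" using J A X C by auto
    have RC: "?R \<in> carrier_mat n n" using A by auto
    have "A * ?Y = J * A * (C + A * X)"
      unfolding JA using assoc_mult_mat[OF A J(1), of "C + A * X" n] C A X by auto
    hence "A * ?Y * B = J * (A * C * B + A * (A * X * B))"
      using J(1) A X B C by (simp add: mat_ring)
    moreover have "C = J * (?R * C)"
      using assoc_mult_mat[OF J(1) RC C] J C by simp
    ultimately have "A * ?Y * B + C = J * (A * C * B + A * (A * X * B)) + J * (?R * C)"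
      by simp
    also have "\<dots> = J * ((A * C * B + A * (A * X * B)) + ?R * C)"
      by (rule mult_add_distrib_mat[symmetric, OF J(1)], insert A X B C, auto)
    also have "(A * C * B + A * (A * X * B)) + ?R * C = C + A * (A * X * B + C * ?D)"
      using A X B C by (simp add: mat_ring) (auto simp: mat_eq_iff_index)
    finally have Yeq: "?Y = A * ?Y * B + C" using eq by simp
    have "cyclic_range n A V ?Y" if cC: "cyclic_range n A V C"
      unfolding cyclic_range_def
    proof
      fix y :: "complex mat" assume y: "y \<in> carrier_mat n 1"
      have "cyclic_range n A V (C * ?D)" unfolding cyclic_range_def
      proof
        fix y :: "complex mat" assume y: "y \<in> carrier_mat n 1"
        hence "?D * y \<in> carrier_mat n 1" using D by auto
        moreover have "C * ?D * y = C * (?D * y)" using C D y by simp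
        ultimately show "\<exists>M\<in>bicommutant n A. C * ?D * y = M * V"
          using cC unfolding cyclic_range_def by auto
      qed
      with cyc y obtain M1 where M1: "M1 \<in> bicommutant n A" "X * y = M1 * V"
        unfolding cyclic_range_def by auto
      from cC y obtain M2 where M2: "M2 \<in> bicommutant n A" "C * y = M2 * V"
        unfolding cyclic_range_def by auto
      have "J * (M2 + A * M1) \<in> bicommutant n A"
        using M1 M2 Jb A by (simp add: bicommutant_add bicommutant_mult bicommutant_self)
      moreover have "?Y * y = J * (M2 + A * M1) * V"
      proof -
        have "?Y * y = J * (C * y + A * (X * y))" using J(1) C A X y by (simp add: mat_ring)
        thus ?thesis unfolding M1(2) M2(2)
          using J(1) A V bicommutant_carrier[OF M1(1)] bicommutant_carrier[OF M2(1)]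
          by (simp add: mat_ring)
      qed
      ultimately show "\<exists>M\<in>bicommutant n A. ?Y * y = M * V" by blast
    qed
    thus ?case using Y Yeq by blast
  qed
  thus thesis using that by blast
qed

subsection \<open>Cyclic vectors and symmetric intertwiners\<close>

text \<open>The range of V D lies on the line through V, hence the range of the solution lies in the
  Krylov space of V. Uniqueness identifies that solution with X, and an invertible X has full
  range.\<close>

lemma cyclic_of_gramian:
  fixes A B :: "complex mat"
  assumes A: "A \<in> carrier_mat n n" and B: "B \<in> carrier_mat n n" and nr: "nonresonant A B"
    and V: "V \<in> carrier_mat n 1" and D: "D \<in> carrier_mat 1 n"
    and X: "X \<in> carrier_mat n n" "X = A * X * B + V * D"
    and Y: "Y \<in> carrier_mat n n" "X * Y = 1\<^sub>m n" and x: "x \<in> carrier_mat n 1"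
  obtains M where "M \<in> bicommutant n A" "M * V = x"
proof -
  have VD: "V * D \<in> carrier_mat n n" using V D by auto
  have "cyclic_range n A V (V * D)" unfolding cyclic_range_def
  proof
    fix y :: "complex mat" assume y: "y \<in> carrier_mat n 1"
    let ?s = "(D * y) $$ (0, 0)"
    have "D * y = ?s \<cdot>\<^sub>m 1\<^sub>m 1" using D y by (intro eq_matI) auto
    hence "V * D * y = V * (?s \<cdot>\<^sub>m 1\<^sub>m 1)" using V D y by (simp add: mat_assoc)
    also have "\<dots> = (?s \<cdot>\<^sub>m 1\<^sub>m n) * V" using V by (simp add: mat_ring)
    finally show "\<exists>M\<in>bicommutant n A. V * D * y = M * V"
      using bicommutant_smult[OF bicommutant_one] by blast
  qed
  with sylvester_exists[OF A B nr VD V] obtain X' where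
    X': "X' \<in> carrier_mat n n" "X' = A * X' * B + V * D" "cyclic_range n A V X'" by blast
  have "X' = X" using sylvester_unique[OF A B nr X'(1,2) X VD] .
  moreover have "X * (Y * x) = x" using X(1) Y x by (simp flip: mat_assoc)
  moreover have "Y * x \<in> carrier_mat n 1" using Y x by auto
  ultimately show thesis using X'(3) that unfolding cyclic_range_def by metis
qed

text \<open>Pick M_i in the bicommutant with M_i V = e_i. The form K_ij = G^T M_i M_j V is symmetric
  because the M_i commute. For N in the bicommutant, K N has entries G^T M_i N M_j V and is
  symmetric too; N = 1 and N = A give symmetry and intertwining, while G^T M_i V = G_i gives K V =
  G.\<close>

lemma symmetric_intertwiner:
  fixes A V G :: "'a :: field mat"
  assumes A: "A \<in> carrier_mat n n" and V: "V \<in> carrier_mat n 1" and G: "G \<in> carrier_mat n 1"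
    and cyclic: "\<And>x. x \<in> carrier_mat n 1 \<Longrightarrow> \<exists>M \<in> bicommutant n A. M * V = x"
  obtains K where "K \<in> carrier_mat n n" "transpose_mat K = K" "K * A = transpose_mat A * K" "K * V = G"
proof -
  define e where "e j = (mat n 1 (\<lambda>(i, _). if i = j then 1 else 0) :: 'a mat)" for j :: nat
  have e: "e j \<in> carrier_mat n 1" for j by (auto simp: e_def)
  obtain M where M: "\<And>j. M j \<in> bicommutant n A" "\<And>j. M j * V = e j"
    using cyclic[OF e] by metis
  note Mc = bicommutant_carrier[OF M(1)]
  have col_e: "(Z * e j) $$ (0, 0) = Z $$ (0, j)" if "Z \<in> carrier_mat 1 n" "j < n" for Z j
  proof -
    have "(Z * e j) $$ (0, 0) = (\<Sum>i\<in>{0..<n}. Z $$ (0, i) * (if i = j then 1 else 0))"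
      using that by (simp add: e_def scalar_prod_def)
    also have "\<dots> = (\<Sum>i\<in>{0..<n}. if i = j then Z $$ (0, i) else 0)" by (rule sum.cong) auto
    finally show ?thesis using that by simp
  qed
  define K where "K = mat n n (\<lambda>(i, j). (transpose_mat G * M i) $$ (0, j))"
  have K: "K \<in> carrier_mat n n" by (simp add: K_def)
  have K_mult: "(K * Z) $$ (i, j) = (transpose_mat G * M i * Z) $$ (0, j)"
    if "Z \<in> carrier_mat n m" "i < n" "j < m" for Z m i j
    using that G Mc[of i] by (auto simp: K_def scalar_prod_def simp del: assoc_mult_mat)
  have KN: "K * N = transpose_mat (K * N)" if N: "N \<in> bicommutant n A" for N
  proof (rule eq_matI)
    have Nc: "N \<in> carrier_mat n n" using bicommutant_carrier[OF N] .
    have entry: "(K * N) $$ (i, j) = (transpose_mat G * (M i * (N * (M j * V)))) $$ (0, 0)"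
      if "i < n" "j < n" for i j
      using that K_mult[OF Nc] col_e[of "transpose_mat G * M i * N" j] G Mc[of i] Mc[of j] Nc M(2)[of j] e[of j]
      by (simp add: mat_assoc del: index_mult_mat(1))
    have swap: "M i * (N * (M j * V)) = M j * (N * (M i * V))" for i j
    proof -
      note comm = bicommutant_commutes(1)[OF A]
      have "M i * (N * (M j * V)) = (M i * (N * M j)) * V"
        using Mc[of i] Mc[of j] Nc V by (simp add: mat_assoc)
      also have "M i * (N * M j) = M j * (N * M i)"
        unfolding comm[OF N M(1)] assoc_mult_mat[OF Mc Mc Nc, symmetric] comm[OF M(1)[of i] M(1)[of j]] ..
      also have "(M j * (N * M i)) * V = M j * (N * (M i * V))"
        using Mc[of i] Mc[of j] Nc V by (simp add: mat_assoc)
      finally show ?thesis .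
    qed
    fix i j assume "i < dim_row (transpose_mat (K * N))" "j < dim_col (transpose_mat (K * N))"
    hence ij: "i < n" "j < n" using K Nc by auto
    show "(K * N) $$ (i, j) = transpose_mat (K * N) $$ (i, j)"
      using entry[OF ij] entry[OF ij(2,1)] swap[of i j] ij K Nc by simp
  qed (insert K bicommutant_carrier[OF N], auto)
  have sym: "transpose_mat K = K" using KN[OF bicommutant_one] K by simp
  have "K * A = transpose_mat A * K" using KN[OF bicommutant_self[OF A]] sym K A by (simp add: mat_ring)
  moreover have "K * V = G"
  proof (rule eq_matI)
    fix i j assume "i < dim_row G" "j < dim_col G"
    hence ij: "i < n" "j = 0" using G by auto
    have "(K * V) $$ (i, 0) = (transpose_mat G * e i) $$ (0, 0)"
      using K_mult[OF V ij(1), of 0] M(2)[of i] Mc[of i] G V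
      by (simp add: mat_assoc del: index_mult_mat(1))
    thus "(K * V) $$ (i, j) = G $$ (i, j)" using col_e[of "transpose_mat G" i] G ij by simp
  qed (insert K V G, auto)
  ultimately show thesis using that K sym by blast
qed

subsection \<open>Completing a Gramian factorization\<close>

lemma four_block_mat_inject:
  assumes "A \<in> carrier_mat n m" "B \<in> carrier_mat n k" "C \<in> carrier_mat l m" "D \<in> carrier_mat l k"
    "A' \<in> carrier_mat n m" "B' \<in> carrier_mat n k" "C' \<in> carrier_mat l m" "D' \<in> carrier_mat l k"
    "four_block_mat A B C D = four_block_mat A' B' C' D'"
  shows "A = A'" "B = B'" "C = C'" "D = D'"
proof -
  have *: "four_block_mat A B C D $$ (i, j) = four_block_mat A' B' C' D' $$ (i, j)" for i j
    using assms(9) by simp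
  show "A = A'"
  proof (rule eq_matI)
    fix i j assume "i < dim_row A'" "j < dim_col A'"
    thus "A $$ (i, j) = A' $$ (i, j)" using *[of i j] assms(1-8) by auto
  qed (insert assms, auto)
  show "B = B'"
  proof (rule eq_matI)
    fix i j assume "i < dim_row B'" "j < dim_col B'"
    thus "B $$ (i, j) = B' $$ (i, j)" using *[of i "m + j"] assms(1-8) by auto
  qed (insert assms, auto)
  show "C = C'"
  proof (rule eq_matI)
    fix i j assume "i < dim_row C'" "j < dim_col C'"
    thus "C $$ (i, j) = C' $$ (i, j)" using *[of "n + i" j] assms(1-8) by auto
  qed (insert assms, auto)
  show "D = D'"
  proof (rule eq_matI)
    fix i j assume "i < dim_row D'" "j < dim_col D'"
    thus "D $$ (i, j) = D' $$ (i, j)" using *[of "n + i" "m + j"] assms(1-8) by auto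
  qed (insert assms, auto)
qed

text \<open>Vectors are handled as n x 1 matrices in the Gramian argument, so that ring rules and
  block products apply to them; this moves the determinant criterion to that form.\<close>

lemma singular_mat_kernel_column:
  fixes W :: "'a :: field mat"
  assumes W: "W \<in> carrier_mat n n" and "det W = 0"
  obtains x where "x \<in> carrier_mat n 1" "x \<noteq> 0\<^sub>m n 1" "W * x = 0\<^sub>m n 1"
proof -
  obtain u where u: "u \<in> carrier_vec n" "u \<noteq> 0\<^sub>v n" "W *\<^sub>v u = 0\<^sub>v n"
    using det_0_iff_vec_prod_zero_field[OF W] assms(2) by auto
  let ?x = "mat n 1 (\<lambda>(i, _). u $ i)"
  have colx: "col ?x 0 = u" using u by (intro eq_vecI) auto
  have "W * ?x = 0\<^sub>m n 1"
  proof (rule eq_matI)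
    fix i j assume "i < dim_row (0\<^sub>m n 1 :: 'a mat)" "j < dim_col (0\<^sub>m n 1 :: 'a mat)"
    hence ij: "i < n" "j = 0" by auto
    have "(W * ?x) $$ (i, 0) = (W *\<^sub>v u) $ i" using ij W colx by simp
    thus "(W * ?x) $$ (i, j) = 0\<^sub>m n 1 $$ (i, j)" using u ij by simp
  qed (insert W, auto)
  moreover have "?x \<noteq> 0\<^sub>m n 1"
  proof
    assume "?x = 0\<^sub>m n 1"
    hence "col ?x 0 = col (0\<^sub>m n 1) 0" by simp
    thus False using u colx by (auto simp: col_def zero_vec_def)
  qed
  ultimately show thesis using that[of ?x] by auto
qed

lemma nonsingular_kernel_column:
  fixes W :: "'a :: field mat"
  assumes W: "W \<in> carrier_mat n n" and "det W \<noteq> 0" and x: "x \<in> carrier_mat n 1" "W * x = 0\<^sub>m n 1"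
  shows "x = 0\<^sub>m n 1"
proof -
  from det_non_zero_imp_unit[OF W assms(2), of "()"] obtain J where
    J: "J \<in> carrier_mat n n" "J * W = 1\<^sub>m n" unfolding Units_def ring_mat_def by auto
  have "J * (W * x) = x" using J W x(1) by (simp flip: mat_assoc)
  thus ?thesis using x(2) J by simp
qed

text \<open>The right-hand blocks have width 0, which makes a stacked column a four-block matrix and
  lets the block product rule act on it.\<close>

lemma column_split:
  assumes "x \<in> carrier_mat (n + 1) 1"
  obtains y t where "y \<in> carrier_mat n 1" "t \<in> carrier_mat 1 1" "x = four_block_mat y (0\<^sub>m n 0) t (0\<^sub>m 1 0)"
proof
  show "mat n 1 (\<lambda>(i, _). x $$ (i, 0)) \<in> carrier_mat n 1" "mat 1 1 (\<lambda>_. x $$ (n, 0)) \<in> carrier_mat 1 1"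
    by simp_all
  show "x = four_block_mat (mat n 1 (\<lambda>(i, _). x $$ (i, 0))) (0\<^sub>m n 0) (mat 1 1 (\<lambda>_. x $$ (n, 0))) (0\<^sub>m 1 0)"
    using assms by (intro eq_matI) (auto simp: less_Suc_eq)
qed

lemma column_eq_zero_iff:
  assumes "y \<in> carrier_mat n 1" "t \<in> carrier_mat 1 1"
  shows "four_block_mat y (0\<^sub>m n 0) t (0\<^sub>m 1 0) = 0\<^sub>m (n + 1) 1 \<longleftrightarrow> y = 0\<^sub>m n 1 \<and> t = 0\<^sub>m 1 1"
proof -
  have zero: "0\<^sub>m (n + 1) 1 = four_block_mat (0\<^sub>m n 1) (0\<^sub>m n 0) (0\<^sub>m 1 1) (0\<^sub>m 1 0)"
    by (intro eq_matI) auto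
  show ?thesis
  proof
    assume "four_block_mat y (0\<^sub>m n 0) t (0\<^sub>m 1 0) = 0\<^sub>m (n + 1) 1"
    from four_block_mat_inject(1,3)[OF assms(1) zero_carrier_mat[of n 0] assms(2) zero_carrier_mat
        _ zero_carrier_mat _ zero_carrier_mat this[unfolded zero]]
    show "y = 0\<^sub>m n 1 \<and> t = 0\<^sub>m 1 1" by simp
  qed (simp add: zero)
qed

lemma four_block_mult_column:
  assumes "A \<in> carrier_mat n n" "B \<in> carrier_mat n 1" "C \<in> carrier_mat 1 n" "D \<in> carrier_mat 1 1"
    "y \<in> carrier_mat n 1" "t \<in> carrier_mat 1 1"
  shows "four_block_mat A B C D * four_block_mat y (0\<^sub>m n 0) t (0\<^sub>m 1 0)
    = four_block_mat (A * y + B * t) (0\<^sub>m n 0) (C * y + D * t) (0\<^sub>m 1 0)"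
  by (subst mult_four_block_mat[OF assms(1-5) _ assms(6)]) (insert assms, auto)

text \<open>The rows of the block row (A V) are orthonormal for the bilinear form diag(P, 1), with Gram
  matrix P; completing them by one more row (transpose G, s) to a square matrix W that preserves
  this form, and passing from W to its inverse, yields the dual identities.\<close>

lemma gramian_completion:
  fixes A P V :: "complex mat"
  assumes A: "A \<in> carrier_mat n n" and V: "V \<in> carrier_mat n 1"
    and P: "P \<in> carrier_mat n n" "P = A * P * transpose_mat A + V * transpose_mat V" "transpose_mat P = P"
    and J: "J \<in> carrier_mat n n" "P * J = 1\<^sub>m n"
  obtains G s where "G \<in> carrier_mat n 1"
    "J = transpose_mat A * J * A + G * transpose_mat G"
    "A * P * G = - s \<cdot>\<^sub>m V"
    "transpose_mat A * J * V = - s \<cdot>\<^sub>m G"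
    "transpose_mat V * J * V = (1 - s * s) \<cdot>\<^sub>m 1\<^sub>m 1"
proof -
  have JP: "J * P = 1\<^sub>m n" using mat_mult_left_right_inverse[OF P(1) J] .
  \<comment> \<open>The padding row of zeros makes the matrix singular. A kernel vector (G, T) is a
    nonzero row that is orthogonal to the rows of (A V) for diag(P, 1).\<close>
  have "four_block_mat (A * P) V (0\<^sub>m 1 n) (0\<^sub>m 1 1) \<in> carrier_mat (n + 1) (n + 1)"
    using A P V by auto
  moreover have "det (four_block_mat (A * P) V (0\<^sub>m 1 n) (0\<^sub>m 1 1)) = 0"
    by (subst det_four_block_mat_lower_left_zero[of _ n _ 1]) (insert A P V, auto)
  ultimately obtain z where z: "z \<in> carrier_mat (n + 1) 1" "z \<noteq> 0\<^sub>m (n + 1) 1"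
    "four_block_mat (A * P) V (0\<^sub>m 1 n) (0\<^sub>m 1 1) * z = 0\<^sub>m (n + 1) 1"
    by (rule singular_mat_kernel_column)
  obtain G T where G: "G \<in> carrier_mat n 1" and T: "T \<in> carrier_mat 1 1"
    and zG: "z = four_block_mat G (0\<^sub>m n 0) T (0\<^sub>m 1 0)" by (rule column_split[OF z(1)])
  have GT: "A * P * G + V * T = 0\<^sub>m n 1"
    using z(3) unfolding zG
    by (subst (asm) four_block_mult_column, insert A P V G T, simp_all)
      (subst (asm) column_eq_zero_iff[simplified], auto)
  let ?GT = "transpose_mat G" and ?AT = "transpose_mat A" and ?VT = "transpose_mat V"
  have TT: "transpose_mat T = T" using T by (intro eq_matI) auto
  have nonzero: "\<not> (G = 0\<^sub>m n 1 \<and> T = 0\<^sub>m 1 1)"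
    using z(2) column_eq_zero_iff[OF G T] unfolding zG by simp
  define Wt where "Wt = four_block_mat ?AT G ?VT T"
  have Wt: "Wt \<in> carrier_mat (n + 1) (n + 1)" using A V G T unfolding Wt_def by auto
  have det_Wt: "det Wt \<noteq> 0"
  proof
    assume "det Wt = 0"
    with Wt obtain x where x: "x \<in> carrier_mat (n + 1) 1" "x \<noteq> 0\<^sub>m (n + 1) 1" "Wt * x = 0\<^sub>m (n + 1) 1"
      by (rule singular_mat_kernel_column)
    obtain y u where y: "y \<in> carrier_mat n 1" and u: "u \<in> carrier_mat 1 1"
      and xy: "x = four_block_mat y (0\<^sub>m n 0) u (0\<^sub>m 1 0)" by (rule column_split[OF x(1)])
    have AVy: "?AT * y + G * u = 0\<^sub>m n 1 \<and> ?VT * y + T * u = 0\<^sub>m 1 1"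
      using x(3) unfolding xy Wt_def
      by (subst (asm) four_block_mult_column, insert A V G T y u, simp_all)
        (subst (asm) column_eq_zero_iff[simplified], auto)
    \<comment> \<open>Multiplying \<open>Wt\<close> x = 0 from the left by the block row (A P, V)
      isolates P y, by the equation for P and the orthogonality of (G, T).\<close>
    have "P * y + (A * P * G + V * T) * u = A * P * (?AT * y + G * u) + V * (?VT * y + T * u)"
      using A P(1) V G T y u by (subst P(2)) (simp add: mat_ring, auto simp: mat_eq_iff_index)
    also have "\<dots> = 0\<^sub>m n 1" using AVy A P(1) V by simp
    finally have "P * y = 0\<^sub>m n 1" unfolding GT using P(1) y u by simp
    moreover have "J * (P * y) = y" using JP J P(1) y by (simp flip: mat_assoc)
    ultimately have y0: "y = 0\<^sub>m n 1" using J by simp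
    hence Gu: "G * u = 0\<^sub>m n 1" "T * u = 0\<^sub>m 1 1" using AVy A V G T u by auto
    have us: "u = u $$ (0, 0) \<cdot>\<^sub>m 1\<^sub>m 1" using u by (intro eq_matI) auto
    have "u $$ (0, 0) \<noteq> 0" using x(2) column_eq_zero_iff[OF y u] y0 us unfolding xy by auto
    moreover have "u $$ (0, 0) \<cdot>\<^sub>m G = 0\<^sub>m n 1" "u $$ (0, 0) \<cdot>\<^sub>m T = 0\<^sub>m 1 1"
      using Gu G T by (subst (asm) us, subst (asm) (2) us, simp add: mat_ring)+
    ultimately show False using nonzero G T by (auto simp: mat_eq_iff_index)
  qed
  define q where "q = (?GT * P * G + T * T) $$ (0, 0)"
  have q: "?GT * P * G + T * T = q \<cdot>\<^sub>m 1\<^sub>m 1" using G P T by (intro eq_matI) (auto simp: q_def)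
  \<comment> \<open>q is the value of the form diag(P, 1) on the new row. Were it 0, the transpose
    of \<open>Wt\<close> would kill the column (P G, T), so G and T would vanish.\<close>
  have "q \<noteq> 0"
  proof
    assume q0: "q = 0"
    have PG: "P * G \<in> carrier_mat n 1" using P G by auto
    have W: "transpose_mat Wt = four_block_mat A V ?GT T"
      unfolding Wt_def using A V G T TT
      by (subst transpose_four_block_mat[of _ n n _ 1 _ 1]) auto
    have "A * (P * G) + V * T = 0\<^sub>m n 1" using GT A P(1) G by (simp add: mat_assoc)
    moreover have "?GT * (P * G) + T * T = 0\<^sub>m 1 1"
      using q q0 P(1) G by (simp add: mat_assoc) (simp add: mat_eq_iff_index)
    ultimately have "transpose_mat Wt * four_block_mat (P * G) (0\<^sub>m n 0) T (0\<^sub>m 1 0) = 0\<^sub>m (n + 1) 1"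
      unfolding W using A V G T PG
      by (subst four_block_mult_column) simp_all
    moreover have "det (transpose_mat Wt) \<noteq> 0" using det_Wt det_transpose[OF Wt] by simp
    moreover have "four_block_mat (P * G) (0\<^sub>m n 0) T (0\<^sub>m 1 0) \<in> carrier_mat (n + 1) 1"
      using PG T by (intro carrier_matI) auto
    moreover have "transpose_mat Wt \<in> carrier_mat (n + 1) (n + 1)" using Wt by auto
    ultimately have "four_block_mat (P * G) (0\<^sub>m n 0) T (0\<^sub>m 1 0) = 0\<^sub>m (n + 1) 1"
      using nonsingular_kernel_column by blast
    hence "P * G = 0\<^sub>m n 1" "T = 0\<^sub>m 1 1" using column_eq_zero_iff[OF PG T] by auto
    moreover have "J * (P * G) = G" using JP J P(1) G by (simp flip: mat_assoc)
    ultimately show False using nonzero J by auto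
  qed
  define r where "r = csqrt q"
  have r: "r * r = q" "r \<noteq> 0" using \<open>q \<noteq> 0\<close> by (auto simp: r_def simp flip: power2_eq_square)
  define F s where "F = (1 / r) \<cdot>\<^sub>m G" and "s = T $$ (0, 0) / r"
  let ?S = "s \<cdot>\<^sub>m (1\<^sub>m 1 :: complex mat)" and ?FT = "transpose_mat F"
  have S: "?S = (1 / r) \<cdot>\<^sub>m T" using T by (intro eq_matI) (auto simp: s_def)
  have F: "F \<in> carrier_mat n 1" using G by (simp add: F_def)
  have FV: "A * P * F + V * ?S = 0\<^sub>m n 1"
  proof -
    have "A * P * F + V * ?S = (1 / r) \<cdot>\<^sub>m (A * P * G + V * T)"
      unfolding S F_def using A P(1) V G T by (simp add: mat_ring) (auto simp: mat_eq_iff_index algebra_simps)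
    thus ?thesis using GT by simp
  qed
  have FF: "?FT * P * F + ?S * ?S = 1\<^sub>m 1"
  proof -
    have "?FT * P * F + ?S * ?S = (1 / (r * r)) \<cdot>\<^sub>m (?GT * P * G + T * T)"
      unfolding S F_def using P(1) G T by (simp add: mat_ring) (auto simp: mat_eq_iff_index add_divide_distrib)
    thus ?thesis unfolding q r(1) using \<open>q \<noteq> 0\<close> by (simp add: mat_eq_iff_index)
  qed
  \<comment> \<open>\<open>?W'\<close> is diag(P, 1) W^T diag(J, 1), the inverse that W diag(P, 1)
    W^T = diag(P, 1) dictates.\<close>
  let ?W = "four_block_mat A V ?FT ?S" and ?W' = "four_block_mat (P * ?AT * J) (P * F) (?VT * J) ?S"
  have W: "?W \<in> carrier_mat (n + 1) (n + 1)" "?W' \<in> carrier_mat (n + 1) (n + 1)"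
    using A P(1) V F J by auto
  have "?W * ?W' = 1\<^sub>m (n + 1)"
  proof -
    have 1: "A * (P * ?AT * J) + V * (?VT * J) = 1\<^sub>m n"
      unfolding J(2)[symmetric] using A P(1) V J(1) by (subst (2) P(2)) (simp add: mat_ring)
    have 2: "A * (P * F) + V * ?S = 0\<^sub>m n 1" using FV A P(1) F by (simp add: mat_assoc)
    have 3: "?FT * (P * ?AT * J) + ?S * (?VT * J) = 0\<^sub>m 1 n"
    proof -
      have "?FT * (P * ?AT * J) + ?S * (?VT * J) = transpose_mat (A * P * F + V * ?S) * J"
        using A P(1,3) F V J(1) by (simp add: mat_ring)
      thus ?thesis unfolding FV using J by simp
    qed
    have 4: "?FT * (P * F) + ?S * ?S = 1\<^sub>m 1" using FF P(1) F by (simp add: mat_assoc)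
    show ?thesis
      by (subst mult_four_block_mat[of _ n n _ 1 _ 1 _ _ n _ 1])
        (insert A P(1) F V J(1), simp_all only: 1 2 3 4 four_block_one_mat, auto)
  qed
  \<comment> \<open>Reversing the product is the passage to the dual: the blocks of this identity,
    with P cancelled where it stands in front, are the claims about J.\<close>
  hence "?W' * ?W = 1\<^sub>m (n + 1)" by (rule mat_mult_left_right_inverse[OF W])
  hence "four_block_mat (P * ?AT * J * A + P * F * ?FT) (P * ?AT * J * V + P * F * ?S)
      (?VT * J * A + ?S * ?FT) (?VT * J * V + ?S * ?S)
    = four_block_mat (1\<^sub>m n) (0\<^sub>m n 1) (0\<^sub>m 1 n) (1\<^sub>m 1)"
    by (subst (asm) mult_four_block_mat[of _ n n _ 1 _ 1 _ _ n _ 1], insert A P(1) F V J(1)) auto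
  note dual = four_block_mat_inject[OF _ _ _ _ _ _ _ _ this, of n n 1 1]
  have 1: "P * ?AT * J * A + P * F * ?FT = 1\<^sub>m n" by (rule dual(1)) (insert A P(1) F V J(1), auto)
  have 2: "P * ?AT * J * V + P * F * ?S = 0\<^sub>m n 1" by (rule dual(2)) (insert A P(1) F V J(1), auto)
  have 4: "?VT * J * V + ?S * ?S = 1\<^sub>m 1" by (rule dual(4)) (insert A P(1) F V J(1), auto)
  have JPm: "J * (P * Z) = Z" if "dim_row Z = n" for Z :: "complex mat"
    using JP J(1) P(1) that by (simp flip: mat_assoc)
  show thesis
  proof (rule that[OF F])
    have "J = J * (P * ?AT * J * A + P * F * ?FT)" using 1 J by simp
    also have "\<dots> = ?AT * J * A + F * ?FT"
      using A P(1) F J(1) by (simp add: mat_ring JPm)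
    finally show "J = ?AT * J * A + F * ?FT" .
    show "A * P * F = - s \<cdot>\<^sub>m V"
      using FV A P(1) F V by (auto simp: mat_eq_iff_index mat_smult eq_neg_iff_add_eq_0 simp del: index_mult_mat(1))
    have "?AT * J * V + F * ?S = J * (P * ?AT * J * V + P * F * ?S)"
      using A P(1) F V J(1) by (simp add: mat_ring JPm)
    also have "\<dots> = 0\<^sub>m n 1" using 2 J by simp
    finally show "?AT * J * V = - s \<cdot>\<^sub>m F"
      using A J(1) F V by (auto simp: mat_eq_iff_index mat_smult eq_neg_iff_add_eq_0 simp del: index_mult_mat(1))
    show "?VT * J * V = (1 - s * s) \<cdot>\<^sub>m 1\<^sub>m 1"
      using 4 J(1) V by (auto simp: mat_eq_iff_index eq_diff_eq simp del: index_mult_mat(1))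
        (simp add: eq_diff_eq)
  qed
qed

subsection \<open>The similarity\<close>

lemma nonresonant_transpose:
  assumes "A \<in> carrier_mat n n" "B \<in> carrier_mat n n"
  shows "nonresonant (transpose_mat A) B = nonresonant A B"
    and "nonresonant A (transpose_mat B) = nonresonant A B"
  using assms by (simp_all add: nonresonant_def)

text \<open>Transposition maps solutions of this equation to solutions.\<close>

lemma gramian_symmetric:
  fixes A P V :: "complex mat"
  assumes A: "A \<in> carrier_mat n n" and nr: "nonresonant A A" and V: "V \<in> carrier_mat n 1"
    and P: "P \<in> carrier_mat n n" "P = A * P * transpose_mat A + V * transpose_mat V"
  shows "transpose_mat P = P"
proof (rule sylvester_unique[OF A _ _ _ _ P])
  show "transpose_mat A \<in> carrier_mat n n" "transpose_mat P \<in> carrier_mat n n"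
    "V * transpose_mat V \<in> carrier_mat n n" using A P(1) V by auto
  show "nonresonant A (transpose_mat A)" using nr nonresonant_transpose[OF A A] by simp
  have "transpose_mat P = transpose_mat (A * P * transpose_mat A + V * transpose_mat V)"
    using P(2) by simp
  also have "\<dots> = A * transpose_mat P * transpose_mat A + V * transpose_mat V"
    using A P(1) V by (simp add: mat_ring)
  finally show "transpose_mat P = A * transpose_mat P * transpose_mat A + V * transpose_mat V" .
qed

lemma gramian_similarity:
  fixes A A2 P Q R V W :: "complex mat"
  assumes A: "A \<in> carrier_mat n n" and V: "V \<in> carrier_mat n 1" and W: "W \<in> carrier_mat n 1"
    and A2: "A2 = A + V * transpose_mat W"
    and nr: "nonresonant A A" "nonresonant A2 A2" "nonresonant A A2"
    and P: "P \<in> carrier_mat n n" "P = A * P * transpose_mat A + V * transpose_mat V"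
    and Q: "Q \<in> carrier_mat n n" "Q = transpose_mat A2 * Q * A2 + W * transpose_mat W"
    and R: "R \<in> carrier_mat n n" "R = A * R * A2 + V * transpose_mat W"
    and J: "J \<in> carrier_mat n n" "P * J = 1\<^sub>m n"
    and L: "L \<in> carrier_mat n n" "Q * L = 1\<^sub>m n"
    and I: "I \<in> carrier_mat n n" "(1\<^sub>m n + P * Q) * I = 1\<^sub>m n"
  shows "similar_mat (J * R * L * transpose_mat R) I"
proof -
  let ?AT = "transpose_mat A" and ?VT = "transpose_mat V" and ?WT = "transpose_mat W"
  have A2c: "A2 \<in> carrier_mat n n" using A V W A2 by auto
  have JP: "J * P = 1\<^sub>m n" by (rule mat_mult_left_right_inverse[OF P(1) J])
  have LQ: "L * Q = 1\<^sub>m n" by (rule mat_mult_left_right_inverse[OF Q(1) L])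
  have Ps: "transpose_mat P = P" by (rule gramian_symmetric[OF A nr(1) V P])
  have Js: "transpose_mat J = J"
  proof -
    have "P * transpose_mat J = transpose_mat (J * P)" using Ps J(1) P(1) by (simp add: mat_ring)
    hence PJt: "P * transpose_mat J = 1\<^sub>m n" using JP by simp
    have "transpose_mat J = J * P * transpose_mat J" using JP J(1) by simp
    also have "\<dots> = J" using PJt P(1) J(1) by (simp add: mat_assoc)
    finally show ?thesis .
  qed
  obtain G s where G: "G \<in> carrier_mat n 1" and JG: "J = ?AT * J * A + G * transpose_mat G"
    and APG: "A * P * G = - s \<cdot>\<^sub>m V" and AJV: "?AT * J * V = - s \<cdot>\<^sub>m G"
    and VJV: "?VT * J * V = (1 - s * s) \<cdot>\<^sub>m 1\<^sub>m 1"
    by (rule gramian_completion[OF A V P Ps J])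
  let ?GT = "transpose_mat G"
  have nrA: "nonresonant A ?AT" "nonresonant ?AT A" using nr(1) nonresonant_transpose[OF A A] by auto
  have ATc: "?AT \<in> carrier_mat n n" and A2T: "transpose_mat A2 \<in> carrier_mat n n" using A A2c by auto
  obtain K where K: "K \<in> carrier_mat n n" and Ks: "transpose_mat K = K"
    and KA: "K * A = ?AT * K" and KV: "K * V = G"
  proof (rule symmetric_intertwiner[OF A V G])
    fix x :: "complex mat" assume x: "x \<in> carrier_mat n 1"
    have "?VT \<in> carrier_mat 1 n" using V by auto
    from cyclic_of_gramian[OF A ATc nrA(1) V this P J x]
    show "\<exists>M \<in> bicommutant n A. M * V = x" by blast
  qed
  have VK: "?VT * K = ?GT" using arg_cong[OF KV, of transpose_mat] K V Ks by (simp add: mat_ring)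
  \<comment> \<open>Congruence by K turns A into A^T and V into G in the equation for P, which
    becomes the dual equation for J.\<close>
  have KPK: "K * P * K = J"
  proof (rule sylvester_unique[OF ATc A nrA(2) _ _ J(1) JG])
    show "K * P * K \<in> carrier_mat n n" "G * ?GT \<in> carrier_mat n n" using K P G by auto
    have "K * P * K = K * (A * P * ?AT + V * ?VT) * K" using P(2) by simp
    also have "\<dots> = (K * A) * P * (?AT * K) + (K * V) * (?VT * K)"
      using K A P(1) V by (simp add: mat_ring)
    also have "\<dots> = (?AT * K) * P * (K * A) + G * ?GT" unfolding KV VK KA ..
    also have "\<dots> = ?AT * (K * P * K) * A + G * ?GT" using K A P(1) by (simp add: mat_assoc)
    finally show "K * P * K = ?AT * (K * P * K) * A + G * ?GT" .
  qed
  define U where "U = P * K"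
  have U: "U \<in> carrier_mat n n" using P K by (auto simp: U_def)
  have UU: "U * U = 1\<^sub>m n"
  proof -
    have "U * U = P * (K * P * K)" using P(1) K by (simp add: U_def mat_assoc)
    thus ?thesis using KPK J by simp
  qed
  \<comment> \<open>U satisfies U = A U A + V G^T, and A U V = A P G = - s V. Replacing the
    right-hand A by A2 therefore adds - s V W^T, and the term s W in H compensates it.\<close>
  define H where "H = G + s \<cdot>\<^sub>m W"
  let ?HT = "transpose_mat H"
  have H: "H \<in> carrier_mat n 1" using G W by (auto simp: H_def)
  have UH: "U = A * U * A2 + V * ?HT"
  proof -
    have "U = (A * P * ?AT + V * ?VT) * K" using P(2) by (simp add: U_def)
    also have "\<dots> = A * P * (?AT * K) + V * (?VT * K)" using A P(1) K V by (simp add: mat_ring)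
    also have "\<dots> = A * U * A + V * ?GT" unfolding KA[symmetric] VK
      using A P(1) K by (simp add: U_def mat_assoc)
    finally have 1: "U = A * U * A + V * ?GT" .
    have "A * U * V = A * P * (K * V)" using A P(1) K V by (simp add: U_def mat_assoc)
    hence 2: "A * U * V = - s \<cdot>\<^sub>m V" using KV APG by simp
    have "A * U * A2 + V * ?HT = A * U * A + (A * U * V) * ?WT + (V * ?GT + s \<cdot>\<^sub>m (V * ?WT))"
      unfolding A2 H_def using A U V W G by (simp add: mat_ring)
    also have "\<dots> = A * U * A + V * ?GT"
      unfolding 2 using A U V W G by (auto simp: mat_eq_iff_index mat_smult simp del: index_mult_mat(1))
    finally show ?thesis using 1 by simp
  qed
  \<comment> \<open>Invertibility of Q makes W cyclic for the transpose of A2. Transposing M then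
    gives a matrix that commutes with A2 and sends W^T to H^T.\<close>
  obtain M where M: "M \<in> bicommutant n (transpose_mat A2)" and MW: "M * W = H"
  proof -
    have "nonresonant (transpose_mat A2) A2" using nr(2) nonresonant_transpose[OF A2c A2c] by simp
    moreover have "?WT \<in> carrier_mat 1 n" using W by auto
    ultimately show thesis using cyclic_of_gramian[OF A2T A2c _ W _ Q L H] that by blast
  qed
  define N where "N = transpose_mat M"
  have Mc: "M \<in> carrier_mat n n" by (rule bicommutant_carrier[OF M])
  have N: "N \<in> carrier_mat n n" using Mc by (simp add: N_def)
  let ?NT = "transpose_mat N"
  have NT: "?NT = M" by (simp add: N_def)
  have NA2: "N * A2 = A2 * N"
    using arg_cong[OF bicommutant_commutes(2)[OF A2T M M], of transpose_mat] Mc A2c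
    by (simp add: mat_transpose N_def)
  have NA2T: "?NT * transpose_mat A2 = transpose_mat A2 * ?NT"
    unfolding NT by (rule bicommutant_commutes(2)[OF A2T M M])
  have WN: "?WT * N = ?HT" using arg_cong[OF MW, of transpose_mat] Mc W by (simp add: mat_transpose N_def)
  have RN: "R * N = U"
  proof (rule sylvester_unique[OF A A2c nr(3) _ _ U UH])
    show "R * N \<in> carrier_mat n n" "V * ?HT \<in> carrier_mat n n" using R(1) N V H by auto
    have "R * N = (A * R * A2 + V * ?WT) * N" using R(2) by simp
    also have "\<dots> = A * R * (A2 * N) + V * (?WT * N)"
      using A R(1) A2c V W N by (simp add: mat_ring)
    also have "\<dots> = A * (R * N) * A2 + V * ?HT" unfolding NA2[symmetric] WN
      using A R(1) A2c N by (simp add: mat_assoc)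
    finally show "R * N = A * (R * N) * A2 + V * ?HT" .
  qed
  have NQN: "?NT * Q * N = J + Q"
  proof (rule sylvester_unique[OF A2T A2c])
    show "nonresonant (transpose_mat A2) A2" using nr(2) nonresonant_transpose[OF A2c A2c] by simp
    show "?NT * Q * N \<in> carrier_mat n n" "J + Q \<in> carrier_mat n n" "H * ?HT \<in> carrier_mat n n"
      using N Q(1) J(1) H by auto
    have "?NT * Q * N = ?NT * (transpose_mat A2 * Q * A2 + W * ?WT) * N" using Q(2) by simp
    also have "\<dots> = (?NT * transpose_mat A2) * Q * (A2 * N) + (?NT * W) * (?WT * N)"
      using N Q(1) A2c W by (simp add: mat_ring)
    also have "\<dots> = transpose_mat A2 * (?NT * Q * N) * A2 + H * ?HT"
      unfolding NA2[symmetric] NA2T WN unfolding NT MW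
      using N Mc Q(1) A2c by (simp add: mat_assoc)
    finally show "?NT * Q * N = transpose_mat A2 * (?NT * Q * N) * A2 + H * ?HT" .
    have AJV': "?VT * J * A = - s \<cdot>\<^sub>m ?GT"
      using arg_cong[OF AJV, of transpose_mat] A J(1) V Js by (simp add: mat_ring)
    have "transpose_mat A2 * J * A2 =
        ?AT * J * A + (?AT * J * V) * ?WT + W * (?VT * J * A) + W * (?VT * J * V) * ?WT"
      unfolding A2 using A J(1) V W by (simp add: mat_ring) (auto simp: mat_eq_iff_index simp del: index_mult_mat(1))
    also have "\<dots> = ?AT * J * A + (- s \<cdot>\<^sub>m (G * ?WT)) + (- s \<cdot>\<^sub>m (W * ?GT)) + (1 - s * s) \<cdot>\<^sub>m (W * ?WT)"
      unfolding AJV AJV' VJV using A J(1) V W G by (simp add: mat_ring)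
    finally have 1: "transpose_mat A2 * J * A2 =
      ?AT * J * A + (- s \<cdot>\<^sub>m (G * ?WT)) + (- s \<cdot>\<^sub>m (W * ?GT)) + (1 - s * s) \<cdot>\<^sub>m (W * ?WT)" .
    have 2: "H * ?HT = G * ?GT + s \<cdot>\<^sub>m (G * ?WT) + s \<cdot>\<^sub>m (W * ?GT) + (s * s) \<cdot>\<^sub>m (W * ?WT)"
      unfolding H_def using G W by (simp add: mat_ring) (auto simp: mat_eq_iff_index algebra_simps simp del: index_mult_mat(1))
    \<comment> \<open>In A2^T J A2 + H H^T the mixed terms cancel, and the coefficients 1 - s^2 and
      s^2 of W W^T add up to 1. The sum is J + W W^T, whose last term is the forcing term of the
      equation for Q.\<close>
    have "J + Q = (?AT * J * A + G * ?GT) + (transpose_mat A2 * Q * A2 + W * ?WT)"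
      using JG Q(2) by simp
    also have "\<dots> = transpose_mat A2 * J * A2 + transpose_mat A2 * Q * A2 + H * ?HT"
      unfolding 1 2 using A J(1) G A2c Q(1) W
      by (auto simp: mat_eq_iff_index algebra_simps simp del: index_mult_mat(1))
    also have "\<dots> = transpose_mat A2 * (J + Q) * A2 + H * ?HT"
      using A2c J(1) Q(1) by (simp add: mat_ring)
    finally show "J + Q = transpose_mat A2 * (J + Q) * A2 + H * ?HT" .
  qed
  text \<open>N is inverse to Y = U R, so N^T Q N = J + Q turns into an expression for R L R^T.\<close>
  define Y where "Y = U * R"
  have Y: "Y \<in> carrier_mat n n" using U R(1) by (simp add: Y_def)
  have YN: "Y * N = 1\<^sub>m n" using RN UU U R(1) N by (simp add: Y_def mat_assoc)
  have NY: "N * Y = 1\<^sub>m n" by (rule mat_mult_left_right_inverse[OF Y N YN])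
  have UY: "U * Y = R" using UU U R(1) by (simp add: Y_def flip: mat_assoc)
  \<comment> \<open>J + Q = J (1 + P Q), so its inverse is I P; this is where the nonsingularity of
    1 + P Q enters.\<close>
  have inv: "(J + Q) * (I * P) = 1\<^sub>m n"
  proof -
    have "J + Q = J * (1\<^sub>m n + P * Q)"
      using J(1) P(1) Q(1) JP by (simp add: mat_distrib flip: mat_assoc)
    hence "(J + Q) * (I * P) = J * (((1\<^sub>m n + P * Q) * I) * P)"
      using J(1) P(1) Q(1) I(1) by (simp add: mat_assoc)
    thus ?thesis using I(2) JP P(1) by simp
  qed
  have YLY: "Y * L * transpose_mat Y = I * P"
  proof -
    let ?X = "Y * L * transpose_mat Y"
    have NtY: "?NT * transpose_mat Y = 1\<^sub>m n"
      using arg_cong[OF YN, of transpose_mat] Y N by (simp add: mat_transpose)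
    have YtN: "transpose_mat Y * ?NT = 1\<^sub>m n"
      using arg_cong[OF NY, of transpose_mat] Y N by (simp add: mat_transpose)
    have X: "?X \<in> carrier_mat n n" using Y L(1) by auto
    have "?X * (J + Q) = Y * (L * ((transpose_mat Y * ?NT) * (Q * N)))"
      unfolding NQN[symmetric] using Y L(1) N Q(1) by (simp add: mat_assoc)
    also have "\<dots> = Y * ((L * Q) * N)" unfolding YtN using Y L(1) N Q(1) by (simp add: mat_assoc)
    also have "\<dots> = 1\<^sub>m n" using LQ YN N by simp
    finally have XJQ: "?X * (J + Q) = 1\<^sub>m n" .
    have "?X = ?X * ((J + Q) * (I * P))"
      unfolding inv by (rule right_mult_one_mat[OF X, symmetric])
    also have "\<dots> = (?X * (J + Q)) * (I * P)"
      by (rule assoc_mult_mat[OF X, symmetric]) (insert J(1) Q(1) I(1) P(1), auto)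
    also have "\<dots> = I * P" unfolding XJQ using I(1) P(1) by simp
    finally show ?thesis .
  qed
  \<comment> \<open>With R = U Y the middle factor becomes I P. Moreover J U = K, and U^T = K P
    because P and K are symmetric.\<close>
  have "J * R * L * transpose_mat R = J * U * (Y * L * transpose_mat Y) * transpose_mat U"
    unfolding UY[symmetric] using J(1) U Y L(1) by (simp add: mat_ring)
  also have "\<dots> = (J * P) * (K * I * (P * (K * P)))"
    unfolding YLY U_def using J(1) P(1) K I(1) Ps Ks by (simp add: mat_ring)
  also have "\<dots> = K * I * (P * (K * P))" unfolding JP using K I(1) P(1) by simp
  finally have eq: "J * R * L * transpose_mat R = K * I * (P * K * P)"
    using P(1) K by (simp add: mat_assoc)
  \<comment> \<open>The involution U = P K says that P K P is the inverse of K, so the product just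
    found is a conjugate of I.\<close>
  have PKP: "(P * K * P) * K = 1\<^sub>m n" using UU P(1) K by (simp add: U_def mat_assoc)
  have c: "P * K * P \<in> carrier_mat n n" using P K by auto
  have "K * (P * K * P) = 1\<^sub>m n" by (rule mat_mult_left_right_inverse[OF c K PKP])
  with eq PKP c K I(1) have "similar_mat_wit (J * R * L * transpose_mat R) I K (P * K * P)"
    unfolding similar_mat_wit_def Let_def by auto
  thus ?thesis unfolding similar_mat_def by blast
qed

subsection \<open>Passage from real to complex matrices\<close>

abbreviation cmat :: "real mat \<Rightarrow> complex mat" where
  "cmat \<equiv> map_mat complex_of_real"

definition ccol :: "real vec \<Rightarrow> complex mat" where
  "ccol v = mat (dim_vec v) 1 (\<lambda>(i, _). complex_of_real (v $ i))"

lemma cmat_ring: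
  shows "dim_col A = dim_row B \<Longrightarrow> cmat (A * B) = cmat A * cmat B"
    and "dim_row A = dim_row B \<Longrightarrow> dim_col A = dim_col B \<Longrightarrow> cmat (A + B) = cmat A + cmat B"
    and "cmat (1\<^sub>m n) = 1\<^sub>m n"
    and "cmat (transpose_mat A) = transpose_mat (cmat A)"
    and "cmat (outer_prod v w) = ccol v * transpose_mat (ccol w)"
proof -
  show "dim_col A = dim_row B \<Longrightarrow> cmat (A * B) = cmat A * cmat B"
    by (rule of_real_hom.mat_hom_mult) auto
  show "cmat (1\<^sub>m n) = 1\<^sub>m n" by (rule of_real_hom.mat_hom_one)
qed (auto intro!: eq_matI simp: outer_prod_def ccol_def scalar_prod_def)

lemma ccol_carrier: "v \<in> carrier_vec n \<Longrightarrow> ccol v \<in> carrier_mat n 1"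
  by (auto simp: ccol_def)

lemma cmat_inject: "cmat A = cmat B \<Longrightarrow> A = B"
  by (rule of_real_hom.mat_hom_inj)

lemma map_mat_Re_mult:
  "dim_col A = dim_row X \<Longrightarrow> map_mat Re (cmat A * X) = A * map_mat Re X"
  "dim_col X = dim_row A \<Longrightarrow> map_mat Re (X * cmat A) = map_mat Re X * A"
  by (auto intro!: eq_matI simp: scalar_prod_def)

text \<open>The real part of a complex solution is again a solution because the coefficients are
  real; uniqueness passes down through the injective embedding.\<close>

lemma real_sylvester_unique:
  assumes A: "A \<in> carrier_mat n n" and B: "B \<in> carrier_mat n n"
    and nr: "nonresonant (cmat A) (cmat B)" and C: "C \<in> carrier_mat n n"
  shows "\<exists>!X. X \<in> carrier_mat n n \<and> X = A * X * B + C"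
proof (rule ex_ex1I)
  have c: "cmat A \<in> carrier_mat n n" "cmat B \<in> carrier_mat n n" "cmat C \<in> carrier_mat n n"
    using A B C by auto
  obtain X where X: "X \<in> carrier_mat n n" "X = cmat A * X * cmat B + cmat C"
    by (rule sylvester_exists[OF c(1,2) nr c(3) zero_carrier_mat])
  have "map_mat Re X = map_mat Re (cmat A * X * cmat B + cmat C)" using X(2) by simp
  also have "\<dots> = map_mat Re (cmat A * X * cmat B) + C"
    using X(1) A B C by (intro eq_matI) auto
  also have "\<dots> = A * map_mat Re X * B + C"
    using X(1) A B by (simp add: map_mat_Re_mult)
  finally show "\<exists>X. X \<in> carrier_mat n n \<and> X = A * X * B + C"
    using X(1) by (intro exI[of _ "map_mat Re X"]) auto
  fix X Y
  assume X: "X \<in> carrier_mat n n \<and> X = A * X * B + C" and Y: "Y \<in> carrier_mat n n \<and> Y = A * Y * B + C"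
  have *: "cmat Z = cmat A * cmat Z * cmat B + cmat C" if "Z \<in> carrier_mat n n" "Z = A * Z * B + C" for Z
  proof -
    have "cmat Z = cmat (A * Z * B + C)" using that(2) by simp
    thus ?thesis using that(1) A B C by (simp add: cmat_ring)
  qed
  have "cmat X = cmat Y"
    by (rule sylvester_unique[OF c(1,2) nr _ *[of X] _ *[of Y] c(3)]) (insert X Y, auto)
  thus "X = Y" by (rule cmat_inject)
qed

lemma inv_mat_inverse:
  assumes M: "M \<in> carrier_mat n n" and inv: "invertible_mat M"
  shows "inv_mat M \<in> carrier_mat n n" "M * inv_mat M = 1\<^sub>m n"
proof -
  obtain B where B: "M * B = 1\<^sub>m n" "B * M = 1\<^sub>m (dim_row B)"
    using inv M unfolding invertible_mat_def inverts_mat_def by auto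
  \<comment> \<open>\<open>invertible_mat\<close> does not fix the size of the inverse; it is read
    off from the column counts of the two identities.\<close>
  have Bc: "B \<in> carrier_mat n n"
    using arg_cong[OF B(1), of dim_col] arg_cong[OF B(2), of dim_col] M by (intro carrier_matI) auto
  have "M \<in> Units (ring_mat TYPE(real) n ())"
    using M B Bc unfolding Units_def ring_mat_def by auto
  with mat_inverse(1)[OF M, of "()"] obtain N where N: "mat_inverse M = Some N" by (cases "mat_inverse M") auto
  from mat_inverse(2)[OF M N] N
  show "inv_mat M \<in> carrier_mat n n" "M * inv_mat M = 1\<^sub>m n" by (auto simp: inv_mat_def)
qed

text \<open>The characteristic polynomial is monic, hence nonzero, so the elements of
  \<open>proots\<close> are exactly its roots.\<close>

lemma set_mset_spec:
  assumes "A \<in> carrier_mat n n"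
  shows "set_mset (spec A) = {a. poly (char_poly (cmat A)) a = 0}"
proof -
  have "char_poly (cmat A) \<noteq> 0" using degree_monic_char_poly[of "cmat A" n] assms by auto
  thus ?thesis by (simp add: spec_def)
qed

theorem theorem3:
  fixes n :: nat and A A2 :: "real mat" and v w :: "real vec"
  assumes n: "n \<ge> 1"
    and A: "A \<in> carrier_mat n n"
    and v: "v \<in> carrier_vec n"
    and w: "w \<in> carrier_vec n"
    and A2: "A2 = A + outer_prod v w"
    and spectral: "\<forall>a \<in> set_mset (spec A) \<union> set_mset (spec A2).
                   \<forall>b \<in> set_mset (spec A) \<union> set_mset (spec A2). a * b \<noteq> 1"
  shows "(\<exists>!P. P \<in> carrier_mat n n \<and> P = A * P * transpose_mat A + outer_prod v v)
    \<and> (\<exists>!Q. Q \<in> carrier_mat n n \<and> Q = transpose_mat A2 * Q * A2 + outer_prod w w)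
    \<and> (\<exists>!R. R \<in> carrier_mat n n \<and> R = A * R * A2 + outer_prod v w)
    \<and> (\<forall>P \<in> carrier_mat n n. \<forall>Q \<in> carrier_mat n n. \<forall>R \<in> carrier_mat n n.
          P = A * P * transpose_mat A + outer_prod v v \<longrightarrow>
          Q = transpose_mat A2 * Q * A2 + outer_prod w w \<longrightarrow>
          R = A * R * A2 + outer_prod v w \<longrightarrow>
          invertible_mat P \<longrightarrow> invertible_mat Q \<longrightarrow> invertible_mat (1\<^sub>m n + P * Q) \<longrightarrow>
          spec (inv_mat P * R * inv_mat Q * transpose_mat R) = spec (inv_mat (1\<^sub>m n + P * Q)))"
proof -
  have outer: "outer_prod x y \<in> carrier_mat n n" if "x \<in> carrier_vec n" "y \<in> carrier_vec n" for x y
    using that by (auto simp: outer_prod_def)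
  have A2c: "A2 \<in> carrier_mat n n" using A A2 outer[OF v w] by auto
  have cA: "cmat A \<in> carrier_mat n n" "cmat A2 \<in> carrier_mat n n" using A A2c by auto
  have nr: "nonresonant (cmat A) (cmat A)" "nonresonant (cmat A2) (cmat A2)"
    "nonresonant (cmat A) (cmat A2)"
    using spectral unfolding nonresonant_def set_mset_spec[OF A] set_mset_spec[OF A2c] by auto
  have nrT: "nonresonant (cmat A) (cmat (transpose_mat A))" "nonresonant (cmat (transpose_mat A2)) (cmat A2)"
    using nr nonresonant_transpose[OF cA(1) cA(1)] nonresonant_transpose[OF cA(2) cA(2)]
    by (simp_all add: cmat_ring)
  have T: "transpose_mat A \<in> carrier_mat n n" "transpose_mat A2 \<in> carrier_mat n n" using A A2c by auto
  show ?thesis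
  proof (intro conjI ballI impI)
    show "\<exists>!P. P \<in> carrier_mat n n \<and> P = A * P * transpose_mat A + outer_prod v v"
      by (rule real_sylvester_unique[OF A T(1) nrT(1) outer[OF v v]])
    show "\<exists>!Q. Q \<in> carrier_mat n n \<and> Q = transpose_mat A2 * Q * A2 + outer_prod w w"
      by (rule real_sylvester_unique[OF T(2) A2c nrT(2) outer[OF w w]])
    show "\<exists>!R. R \<in> carrier_mat n n \<and> R = A * R * A2 + outer_prod v w"
      by (rule real_sylvester_unique[OF A A2c nr(3) outer[OF v w]])
  next
    fix P Q R
    assume P: "P \<in> carrier_mat n n" and Q: "Q \<in> carrier_mat n n" and R: "R \<in> carrier_mat n n"
      and Pe: "P = A * P * transpose_mat A + outer_prod v v"
      and Qe: "Q = transpose_mat A2 * Q * A2 + outer_prod w w"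
      and Re: "R = A * R * A2 + outer_prod v w"
      and inv: "invertible_mat P" "invertible_mat Q" "invertible_mat (1\<^sub>m n + P * Q)"
    have PQ: "1\<^sub>m n + P * Q \<in> carrier_mat n n" using P Q by auto
    note iP = inv_mat_inverse[OF P inv(1)] and iQ = inv_mat_inverse[OF Q inv(2)]
      and iPQ = inv_mat_inverse[OF PQ inv(3)]
    note dims = outer[OF v v, THEN carrier_matD(1)] outer[OF v v, THEN carrier_matD(2)]
      outer[OF v w, THEN carrier_matD(1)] outer[OF v w, THEN carrier_matD(2)]
      outer[OF w w, THEN carrier_matD(1)] outer[OF w w, THEN carrier_matD(2)]
    \<comment> \<open>Similarity yields equal characteristic polynomials, hence equality of the
      spectra with multiplicities.\<close>
    have "similar_mat (cmat (inv_mat P) * cmat R * cmat (inv_mat Q) * transpose_mat (cmat R))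
      (cmat (inv_mat (1\<^sub>m n + P * Q)))"
    proof (rule gramian_similarity[OF cA(1) ccol_carrier[OF v] ccol_carrier[OF w] _ nr])
      show "cmat A2 = cmat A + ccol v * transpose_mat (ccol w)"
        using A by (simp add: A2 cmat_ring dims)
      show "cmat P = cmat A * cmat P * transpose_mat (cmat A) + ccol v * transpose_mat (ccol v)"
        using arg_cong[OF Pe, of cmat] A P by (simp add: cmat_ring dims)
      show "cmat Q = transpose_mat (cmat A2) * cmat Q * cmat A2 + ccol w * transpose_mat (ccol w)"
        using arg_cong[OF Qe, of cmat] A2c Q by (simp add: cmat_ring dims)
      show "cmat R = cmat A * cmat R * cmat A2 + ccol v * transpose_mat (ccol w)"
        using arg_cong[OF Re, of cmat] A A2c R by (simp add: cmat_ring dims)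
      show "cmat P * cmat (inv_mat P) = 1\<^sub>m n"
        using arg_cong[OF iP(2), of cmat] iP(1) P by (simp add: cmat_ring)
      show "cmat Q * cmat (inv_mat Q) = 1\<^sub>m n"
        using arg_cong[OF iQ(2), of cmat] iQ(1) Q by (simp add: cmat_ring)
      show "(1\<^sub>m n + cmat P * cmat Q) * cmat (inv_mat (1\<^sub>m n + P * Q)) = 1\<^sub>m n"
        using arg_cong[OF iPQ(2), of cmat] iPQ(1) P Q by (simp add: cmat_ring)
    qed (insert P Q R iP iQ iPQ, auto)
    moreover have "cmat (inv_mat P * R * inv_mat Q * transpose_mat R)
        = cmat (inv_mat P) * cmat R * cmat (inv_mat Q) * transpose_mat (cmat R)"
      using iP(1) iQ(1) R by (simp add: cmat_ring)
    ultimately show "spec (inv_mat P * R * inv_mat Q * transpose_mat R) = spec (inv_mat (1\<^sub>m n + P * Q))"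
      unfolding spec_def by (simp add: char_poly_similar)
  qed
qed

end
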